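(* Magnitude is multiplicative under direct sums and is a valuative invariant of matroids. That is: for matroids $M_1,M_2$ on disjoint ground sets, $\operatorname{Mag}(M_1\oplus M_2;q)=\operatorname{Mag}(M_1;q)\operatorname{Mag}(M_2;q)$; and for matroids $M_i$ (finitely many) on a fixed ground set and integers $c_i$, $$\sum_ic_i\mathbf 1_{P(M_i)}=0\quad\Longrightarrow\quad\sum_ic_i\operatorname{Mag}(M_i;q)=0.$$
   Context: All matroids are finite. For a matroid $M$ on $E$ with rank function $r_M$ and $r(M)=r_M(E)$, $\chi_M(x)=\sum_{S\subseteq E}(-1)^{|S|}x^{r(M)-r_M(S)}$. For $w\in\mathbb Z_{\ge0}^E$ put $|w|=\sum_ew_e$, $\operatorname{wt}_M(w)=\max_B\sum_{e\in B}w_e$ over bases $B$ of $M$; the maximizing bases are the bases of the initial matroid $M_w$ on $E$. The motivic zeta function is $Z_M(x,T)=\sum_{w\in\mathbb Z_{\ge0}^E}\chi_{M_w}(x)x^{-r(M)-\operatorname{wt}_M(w)}T^{|w|}\in\mathbb Z[x^{\pm1}][[T]]$, and the magnitude is $\operatorname{Mag}(M;q)=Z_M(-1,q)\in\mathbb Z[[q]]$. The base polytope of a matroid $N$ on $E$ is $P(N)=\operatorname{conv}\{\mathbf 1_B:B\text{ a basis of }N\}\subset\mathbb R^E$, and $\mathbf 1_{P(N)}:\mathbb R^E\to\mathbb Z$ is its indicator function. *)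

theory Defs
  imports "HOL-Analysis.Analysis" "HOL-Analysis.Finite_Function_Topology"
    "HOL-Computational_Algebra.Formal_Power_Series"
begin

record 'a basis_system =
  ground :: "'a set"
  bases :: "'a set set"

locale matroid =
  fixes M :: "'a basis_system"
  assumes finite_ground: "finite (ground M)"
    and bases_subset: "B \<in> bases M \<Longrightarrow> B \<subseteq> ground M"
    and bases_nonempty: "bases M \<noteq> {}"
    and bases_exchange: "\<lbrakk>A \<in> bases M; B \<in> bases M; a \<in> A - B\<rbrakk>
      \<Longrightarrow> \<exists>b \<in> B - A. insert b (A - {a}) \<in> bases M"

definition indep :: "'a basis_system \<Rightarrow> 'a set \<Rightarrow> bool" where
  "indep M X \<longleftrightarrow> (\<exists>B \<in> bases M. X \<subseteq> B)"

definition rank_of :: "'a basis_system \<Rightarrow> 'a set \<Rightarrow> nat" where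
  "rank_of M S = Max (card ` {X. X \<subseteq> S \<and> indep M X})"

definition total_rank :: "'a basis_system \<Rightarrow> nat" where
  "total_rank M = rank_of M (ground M)"

definition matroid_iso :: "('a \<Rightarrow> 'b) \<Rightarrow> 'a basis_system \<Rightarrow> 'b basis_system \<Rightarrow> bool" where
  "matroid_iso f M N \<longleftrightarrow> bij_betw f (ground M) (ground N) \<and> bases N = (\<lambda>B. f ` B) ` bases M"

text \<open>The direct sum is only meaningful when the two ground sets are disjoint.\<close>
definition direct_sum :: "'a basis_system \<Rightarrow> 'a basis_system \<Rightarrow> 'a basis_system" where
  "direct_sum M N = \<lparr>ground = ground M \<union> ground N,
     bases = {A \<union> B |A B. A \<in> bases M \<and> B \<in> bases N}\<rparr>"

definition wt :: "'a basis_system \<Rightarrow> ('a \<Rightarrow> nat) \<Rightarrow> nat" where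
  "wt M w = Max ((\<lambda>B. \<Sum>e\<in>B. w e) ` bases M)"

definition initial_matroid :: "'a basis_system \<Rightarrow> ('a \<Rightarrow> nat) \<Rightarrow> 'a basis_system" where
  "initial_matroid M w = \<lparr>ground = ground M, bases = {B \<in> bases M. (\<Sum>e\<in>B. w e) = wt M w}\<rparr>"

text \<open>The group ring of the additive group of integers over the integers, that is,
  the ring of integral Laurent polynomials in one variable \<open>x\<close>.\<close>
type_synonym laurent = "int \<Rightarrow>\<^sub>0 int"

definition xpow :: "int \<Rightarrow> laurent" where
  "xpow k = Poly_Mapping.single k 1"

text \<open>Evaluation at \<open>x = -1\<close>. As \<open>-1\<close> is its own inverse, its \<open>k\<close>-th power is
  its \<open>\<bar>k\<bar>\<close>-th power.\<close>
definition eval_minus_one :: "laurent \<Rightarrow> int" where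
  "eval_minus_one p = (\<Sum>k\<in>Poly_Mapping.keys p. Poly_Mapping.lookup p k * (- 1) ^ nat \<bar>k\<bar>)"

text \<open>The characteristic polynomial, taken directly in the Laurent polynomial ring.\<close>
definition char_poly :: "'a basis_system \<Rightarrow> laurent" where
  "char_poly M = (\<Sum>S\<in>Pow (ground M).
     (- 1) ^ card S * xpow (int (total_rank M) - int (rank_of M S)))"

text \<open>The coefficient of \<open>T ^ n\<close> collects the finitely many weight vectors \<open>w\<close> with \<open>\<bar>w\<bar> = n\<close>.\<close>
definition motivic_zeta :: "'a basis_system \<Rightarrow> laurent fps" where
  "motivic_zeta M = Abs_fps (\<lambda>n.
     \<Sum>w \<in> {w \<in> ground M \<rightarrow>\<^sub>E (UNIV :: nat set). (\<Sum>e\<in>ground M. w e) = n}.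
       char_poly (initial_matroid M w) * xpow (- int (total_rank M) - int (wt M w)))"

definition Mag :: "'a basis_system \<Rightarrow> int fps" where
  "Mag M = Abs_fps (\<lambda>n. eval_minus_one (fps_nth (motivic_zeta M) n))"

text \<open>For finite \<open>E\<close>, the space of real vectors indexed by \<open>E\<close> is realised as the finitely
  supported functions with support in \<open>E\<close>; this is a subspace of the library's real vector space
  of finitely supported functions, so that the library's convex hull applies.\<close>
definition real_space :: "'a set \<Rightarrow> ('a \<Rightarrow>\<^sub>0 real) set" where
  "real_space E = {x. Poly_Mapping.keys x \<subseteq> E}"

definition indicator_vec :: "'a set \<Rightarrow> 'a \<Rightarrow>\<^sub>0 real" where
  "indicator_vec B = (\<Sum>e\<in>B. Poly_Mapping.single e 1)"

definition base_polytope :: "'a basis_system \<Rightarrow> ('a \<Rightarrow>\<^sub>0 real) set" where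
  "base_polytope M = convex hull (indicator_vec ` bases M)"

end

theory Submission
  imports Defs
begin

text \<open>
  At \<open>x = -1\<close> the summand of the zeta function belonging to a weight \<open>w\<close> is the sum of
  \<open>(-1)^(|S| + wt_M(w) + r(S))\<close> over \<open>S \<subseteq> E\<close>, where \<open>r\<close> is the rank function of the initial
  matroid \<open>M_w\<close>. For \<open>k \<ge> |E|\<close>, maximising the weight \<open>k w + 1_S\<close> first maximises \<open>w\<close> and then
  breaks ties by \<open>|B \<inter> S|\<close>, so \<open>wt_M(k w + 1_S) = k wt_M(w) + r(S)\<close>; if moreover \<open>k\<close> is odd, the
  sign above is \<open>(-1)^(|S| + wt_M(k w + 1_S))\<close>. Magnitude is therefore determined by the function
  \<open>wt_M\<close>, which is additive under direct sums, and \<open>wt_M(u)\<close> is the maximum of the linear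
  functional \<open>u\<close> on the base polytope.

  For valuativity it is thus enough that a linear relation between indicator functions of compact
  convex sets forces, for every linear functional \<open>g\<close> and every \<open>k\<close>, the coefficients of the sets
  with \<open>max g = k\<close> to add up to zero. Since the Euler characteristic of compact convex sets respects
  such relations, it can be applied to the slices \<open>g = t\<close>; this turns the relation into one between
  the intervals \<open>g(K_i)\<close>, and comparing its values at \<open>k\<close> and just to the right of \<open>k\<close> isolates the
  intervals ending at \<open>k\<close>. The Euler characteristic statement itself follows by the same slicing
  argument, by induction on the number of coordinates.
\<close>

section \<open>Linear relations between compact convex sets\<close>

lemma sum_right_endpoints_eq_0:
  fixes a b :: "'i \<Rightarrow> real" and c :: "'i \<Rightarrow> 'c::ab_group_add"
  assumes fin: "finite I" and le: "\<And>i. i \<in> I \<Longrightarrow> a i \<le> b i"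
    and zero: "\<And>t. (\<Sum>i | i \<in> I \<and> t \<in> {a i..b i}. c i) = 0"
  shows "(\<Sum>i | i \<in> I \<and> b i = k. c i) = 0"
proof -
  \<comment> \<open>compare the hypothesis at \<open>k\<close> with the one at a point \<open>t\<close> slightly to the right of \<open>k\<close>\<close>
  define X where "X = insert (k + 1) {x \<in> a ` I \<union> b ` I. x > k}"
  define t where "t = (k + Min X) / 2"
  \<comment> \<open>The element \<open>k + 1\<close> keeps \<open>X\<close> nonempty even when no
    endpoint exceeds \<open>k\<close>, so \<open>Min X\<close> is meaningful.\<close>
  have "finite X" "X \<noteq> {}" using fin by (auto simp: X_def)
  then have "Min X > k" by (auto simp: X_def)
  then have t: "k < t" "t < Min X" by (auto simp: t_def)
  \<comment> \<open>No endpoint lies in the half-open interval from \<open>k\<close> (exclusive) to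
    \<open>t\<close> (inclusive), so comparing endpoints with \<open>t\<close> amounts to comparing
    them with \<open>k\<close>.\<close>
  have le_iff: "x \<le> t \<longleftrightarrow> x \<le> k" if "x \<in> a ` I \<union> b ` I" for x
  proof
    assume "x \<le> t"
    show "x \<le> k"
    proof (rule ccontr)
      assume "\<not> x \<le> k"
      with that have "x \<in> X" by (auto simp: X_def)
      with \<open>finite X\<close> have "Min X \<le> x" by simp
      with \<open>x \<le> t\<close> t show False by simp
    qed
  qed (use t in simp)
  have "a i \<le> t \<longleftrightarrow> a i \<le> k" "t \<le> b i \<longleftrightarrow> k < b i" if "i \<in> I" for i
    using that le_iff[of "a i"] le_iff[of "b i"] t(1) by auto
  then have "{i \<in> I. t \<in> {a i..b i}} = {i \<in> I. a i \<le> k \<and> k < b i}"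
    by auto
  then have "(\<Sum>i | i \<in> I \<and> a i \<le> k \<and> k < b i. c i) = 0"
    using zero[of t] by simp
  moreover have "{i \<in> I. k \<in> {a i..b i}} = {i \<in> I. a i \<le> k \<and> k < b i} \<union> {i \<in> I. b i = k}"
    using le by force
  then have "(\<Sum>i | i \<in> I \<and> k \<in> {a i..b i}. c i)
      = (\<Sum>i | i \<in> I \<and> a i \<le> k \<and> k < b i. c i) + (\<Sum>i | i \<in> I \<and> b i = k. c i)"
    using fin by (simp add: sum.union_disjoint disjoint_iff)
  ultimately show ?thesis using zero[of k] by simp
qed

text \<open>Compact connected subsets of the line are closed intervals; \<open>K \<noteq> {}\<close>
  ensures that \<open>Inf\<close> and \<open>Sup\<close> are the endpoints.\<close>

lemma image_compact_convex_eq_interval: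
  fixes f :: "'v::real_normed_vector \<Rightarrow> real"
  assumes "compact K" "convex K" "K \<noteq> {}" "bounded_linear f"
  shows "f ` K = {Inf (f ` K)..Sup (f ` K)}"
proof -
  have "compact (f ` K)"
    using assms by (intro compact_continuous_image linear_continuous_on)
  moreover have "convex (f ` K)"
    using assms by (intro convex_linear_image bounded_linear.linear)
  ultimately obtain a b where ab: "f ` K = {a..b}"
    by (metis connected_compact_interval_1 convex_connected)
  then have "a \<le> b" using \<open>K \<noteq> {}\<close> by auto
  with ab show ?thesis by simp
qed

lemma sum_Sup_slices_eq_0:
  fixes f :: "'v::real_normed_vector \<Rightarrow> real" and c :: "'i \<Rightarrow> 'c::ab_group_add"
  assumes fin: "finite I" and K: "\<And>i. i \<in> I \<Longrightarrow> compact (K i)" "\<And>i. i \<in> I \<Longrightarrow> convex (K i)"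
    and f: "bounded_linear f"
    and zero: "\<And>t. (\<Sum>i | i \<in> I \<and> K i \<inter> f -` {t} \<noteq> {}. c i) = 0"
  shows "(\<Sum>i | i \<in> I \<and> K i \<noteq> {} \<and> Sup (f ` K i) = k. c i) = 0"
proof -
  define J where "J = {i \<in> I. K i \<noteq> {}}"
  have J: "f ` K i = {Inf (f ` K i)..Sup (f ` K i)}" if "i \<in> J" for i
    using that K f by (intro image_compact_convex_eq_interval) (auto simp: J_def)
  have le: "Inf (f ` K i) \<le> Sup (f ` K i)" if "i \<in> J" for i
    using J[OF that] that by (auto simp: J_def)
  have "{i \<in> J. t \<in> {Inf (f ` K i)..Sup (f ` K i)}} = {i \<in> I. K i \<inter> f -` {t} \<noteq> {}}" for t
  proof -
    have "{i \<in> J. t \<in> {Inf (f ` K i)..Sup (f ` K i)}} = {i \<in> J. t \<in> f ` K i}"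
      using J by blast
    then show ?thesis by (auto simp: J_def)
  qed
  then have "(\<Sum>i | i \<in> J \<and> t \<in> {Inf (f ` K i)..Sup (f ` K i)}. c i) = 0" for t
    using zero by simp
  then have "(\<Sum>i | i \<in> J \<and> Sup (f ` K i) = k. c i) = 0"
    using le fin by (intro sum_right_endpoints_eq_0[where a = "\<lambda>i. Inf (f ` K i)"]) (auto simp: J_def)
  then show ?thesis by (simp add: J_def conj_assoc)
qed

text \<open>Additivity of the Euler characteristic on compact convex sets. The separating functionals
  \<open>f e\<close> serve as coordinates: slicing by one of them removes it from \<open>F\<close>.\<close>
lemma sum_nonempty_eq_0:
  fixes f :: "'b \<Rightarrow> 'v::real_normed_vector \<Rightarrow> real" and c :: "'i \<Rightarrow> 'c::ab_group_add"
  assumes "finite F" and fin: "finite I"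
    and "\<And>i. i \<in> I \<Longrightarrow> compact (K i)" "\<And>i. i \<in> I \<Longrightarrow> convex (K i)"
    and "\<And>e. e \<in> F \<Longrightarrow> bounded_linear (f e)"
    and "\<And>x y. x \<in> (\<Union>i\<in>I. K i) \<Longrightarrow> y \<in> (\<Union>i\<in>I. K i) \<Longrightarrow> (\<And>e. e \<in> F \<Longrightarrow> f e x = f e y) \<Longrightarrow> x = y"
    and "\<And>x. (\<Sum>i | i \<in> I \<and> x \<in> K i. c i) = 0"
  shows "(\<Sum>i | i \<in> I \<and> K i \<noteq> {}. c i) = 0"
  using assms(1,3-)
proof (induction F arbitrary: K rule: finite_induct)
  case empty
  show ?case
  proof (cases "\<exists>i\<in>I. K i \<noteq> {}")
    case True
    then obtain x where x: "x \<in> (\<Union>i\<in>I. K i)" by auto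
    \<comment> \<open>With no functionals left, separation says that the union of the sets is the
      single point \<open>x\<close>, so being nonempty means containing \<open>x\<close>.\<close>
    have "{i \<in> I. K i \<noteq> {}} = {i \<in> I. x \<in> K i}"
      using x empty.prems(4) by blast
    then show ?thesis using empty.prems(5) by simp
  next
    case False
    then have "{i \<in> I. K i \<noteq> {}} = {}" by blast
    then show ?thesis by (metis sum.empty)
  qed
next
  case (insert a F)
  have "closed (f a -` {t})" for t
    using insert.prems(3)[of a] by (intro continuous_closed_vimage linear_continuous_at) auto
  moreover have "convex (f a -` {t})" for t
    using insert.prems(3)[of a]
    by (intro convex_linear_vimage bounded_linear.linear) auto
  \<comment> \<open>On a level set of \<open>f a\<close> the functionals in \<open>F\<close> already
    separate points, so the induction hypothesis applies to the slices.\<close>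
  ultimately have "(\<Sum>i | i \<in> I \<and> K i \<inter> f a -` {t} \<noteq> {}. c i) = 0" for t
  proof (intro insert.IH)
    fix x y
    assume xy: "x \<in> (\<Union>i\<in>I. K i \<inter> f a -` {t})" "y \<in> (\<Union>i\<in>I. K i \<inter> f a -` {t})"
      and "\<And>e. e \<in> F \<Longrightarrow> f e x = f e y"
    then show "x = y" by (intro insert.prems(4)) auto
  next
    fix x
    show "(\<Sum>i | i \<in> I \<and> x \<in> K i \<inter> f a -` {t}. c i) = 0"
      using insert.prems(5)[of x] by (cases "f a x = t") auto
  qed (use insert.prems(1-3) fin in \<open>auto intro: compact_Int_closed convex_Int\<close>)
  then have Sup: "(\<Sum>i | i \<in> I \<and> K i \<noteq> {} \<and> Sup (f a ` K i) = k. c i) = 0" for k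
    using fin insert.prems(1-3) by (intro sum_Sup_slices_eq_0) auto
  let ?J = "{i \<in> I. K i \<noteq> {}}"
  \<comment> \<open>Each nonempty set has one maximum of \<open>f a\<close>; grouping by it splits
    the sum into sums that vanish.\<close>
  have "(\<Sum>i\<in>?J. c i)
      = (\<Sum>k\<in>(\<lambda>i. Sup (f a ` K i)) ` ?J. \<Sum>i | i \<in> ?J \<and> Sup (f a ` K i) = k. c i)"
    using fin by (intro sum.image_gen) auto
  also have "\<dots> = 0" using Sup by (simp add: conj_assoc)
  finally show ?case .
qed

text \<open>Slices by \<open>g\<close> remain compact and convex and inherit the relation, so
  \<open>sum_nonempty_eq_0\<close> supplies the hypothesis of
  \<open>sum_Sup_slices_eq_0\<close>.\<close>

lemma sum_Sup_eq_0:
  fixes f :: "'b \<Rightarrow> 'v::real_normed_vector \<Rightarrow> real" and g :: "'v \<Rightarrow> real"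
    and c :: "'i \<Rightarrow> 'c::ab_group_add"
  assumes "finite F" and fin: "finite I"
    and K: "\<And>i. i \<in> I \<Longrightarrow> compact (K i)" "\<And>i. i \<in> I \<Longrightarrow> convex (K i)"
    and f: "\<And>e. e \<in> F \<Longrightarrow> bounded_linear (f e)"
    and sep: "\<And>x y. x \<in> (\<Union>i\<in>I. K i) \<Longrightarrow> y \<in> (\<Union>i\<in>I. K i) \<Longrightarrow> (\<And>e. e \<in> F \<Longrightarrow> f e x = f e y) \<Longrightarrow> x = y"
    and zero: "\<And>x. (\<Sum>i | i \<in> I \<and> x \<in> K i. c i) = 0"
    and g: "bounded_linear g"
  shows "(\<Sum>i | i \<in> I \<and> K i \<noteq> {} \<and> Sup (g ` K i) = k. c i) = 0"
proof (rule sum_Sup_slices_eq_0[where f=g and I=I and c=c and K=K])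
  fix t
  have closed: "closed (g -` {t})"
    using g by (intro continuous_closed_vimage linear_continuous_at) auto
  have convex: "convex (g -` {t})"
    using g by (intro convex_linear_vimage bounded_linear.linear) auto
  show "(\<Sum>i | i \<in> I \<and> K i \<inter> g -` {t} \<noteq> {}. c i) = 0"
  proof (intro sum_nonempty_eq_0[where F = F and f = f])
    fix x
    show "(\<Sum>i | i \<in> I \<and> x \<in> K i \<inter> g -` {t}. c i) = 0"
      using zero[of x] by (cases "g x = t") auto
  next
    fix x y
    assume "x \<in> (\<Union>i\<in>I. K i \<inter> g -` {t})" "y \<in> (\<Union>i\<in>I. K i \<inter> g -` {t})"
      and "\<And>e. e \<in> F \<Longrightarrow> f e x = f e y"
    then show "x = y" by (intro sep) auto
  next
    show "compact (K i \<inter> g -` {t})" if "i \<in> I" for i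
      using that K(1) closed by (intro compact_Int_closed)
    show "convex (K i \<inter> g -` {t})" if "i \<in> I" for i
      using that K(2) convex by (intro convex_Int)
  qed (use assms(1,2) f in simp_all)
qed (use fin K g in simp_all)

section \<open>Signs in the magnitude\<close>

lemma eval_minus_one_superset:
  assumes "finite A" "Poly_Mapping.keys p \<subseteq> A"
  shows "eval_minus_one p = (\<Sum>k\<in>A. Poly_Mapping.lookup p k * (- 1) ^ nat \<bar>k\<bar>)"
  unfolding eval_minus_one_def using assms
  by (intro sum.mono_neutral_left) (auto simp: in_keys_iff)

lemma eval_minus_one_add: "eval_minus_one (p + q) = eval_minus_one p + eval_minus_one q"
proof -
  let ?A = "Poly_Mapping.keys p \<union> Poly_Mapping.keys q"
  have "eval_minus_one (p + q)
      = (\<Sum>k\<in>?A. Poly_Mapping.lookup (p + q) k * (- 1) ^ nat \<bar>k\<bar>)"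
    using keys_add[of p q] by (intro eval_minus_one_superset) auto
  also have "\<dots> = eval_minus_one p + eval_minus_one q"
    by (simp add: eval_minus_one_superset[of ?A] lookup_add algebra_simps sum.distrib)
  finally show ?thesis .
qed

lemma eval_minus_one_uminus: "eval_minus_one (- p) = - eval_minus_one p"
proof -
  have "eval_minus_one 0 = 0" by (simp add: eval_minus_one_def)
  then show ?thesis using eval_minus_one_add[of p "- p"] by simp
qed

lemma eval_minus_one_sum: "eval_minus_one (sum f A) = (\<Sum>x\<in>A. eval_minus_one (f x))"
proof -
  have "eval_minus_one 0 = 0" by (simp add: eval_minus_one_def)
  then show ?thesis
    by (induction A rule: infinite_finite_induct) (auto simp: eval_minus_one_add)
qed

lemma eval_minus_one_xpow: "eval_minus_one (xpow k) = (- 1) ^ nat \<bar>k\<bar>"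
  by (simp add: xpow_def eval_minus_one_def)

lemma xpow_mult: "xpow j * xpow k = xpow (j + k)"
  by (simp add: xpow_def mult_single)

text \<open>The terms of \<open>char_poly\<close> are signs times powers of \<open>x\<close>;
  together with \<open>xpow_mult\<close> this evaluates the products in the zeta function.\<close>

lemma eval_minus_one_sign_mult: "eval_minus_one ((- 1) ^ m * p) = (- 1) ^ m * eval_minus_one p"
  by (cases "even m") (auto simp: eval_minus_one_uminus)

section \<open>Bases and their maximal weight\<close>

lemma (in matroid) finite_bases: "finite (bases M)"
  using finite_ground bases_subset by (intro finite_subset[of "bases M" "Pow (ground M)"]) auto

lemma (in matroid) finite_base: "B \<in> bases M \<Longrightarrow> finite B"
  using finite_ground bases_subset finite_subset by blast

text \<open>Each exchange keeps the size of \<open>A\<close> and brings it one element closer to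
  \<open>B\<close>.\<close>

lemma (in matroid) card_bases_eq:
  assumes "A \<in> bases M" "B \<in> bases M"
  shows "card A = card B"
  using assms
proof (induction "card (A - B)" arbitrary: A rule: less_induct)
  case less
  show ?case
  proof (cases "A \<subseteq> B")
    case True
    \<comment> \<open>An element of \<open>B - A\<close> would have to be exchanged for one of
      \<open>A - B\<close>, which is empty.\<close>
    then have "B \<subseteq> A" using bases_exchange[OF less.prems(2,1)] by blast
    with True show ?thesis by simp
  next
    case False
    then obtain a where a: "a \<in> A - B" by blast
    from bases_exchange[OF less.prems this] obtain b
      where b: "b \<in> B - A" "insert b (A - {a}) \<in> bases M" by blast
    have fin: "finite A" using less.prems finite_base by blast
    have "insert b (A - {a}) - B = (A - B) - {a}" using b by blast
    then have "card (insert b (A - {a}) - B) < card (A - B)"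
      using fin a by (metis card_Diff1_less finite_Diff)
    then have "card (insert b (A - {a})) = card B"
      using less.hyps b(2) less.prems(2) by blast
    moreover have "card (insert b (A - {a})) = card A"
      using a b(1) fin card.remove[OF fin, of a] by simp
    ultimately show ?thesis by simp
  qed
qed

lemma (in matroid) sum_le_wt: "B \<in> bases M \<Longrightarrow> sum w B \<le> wt M w"
  unfolding wt_def using finite_bases by simp

lemma (in matroid) wt_attained:
  obtains B where "B \<in> bases M" "sum w B = wt M w"
proof -
  have "wt M w \<in> sum w ` bases M"
    unfolding wt_def using finite_bases bases_nonempty by (intro Max_in) auto
  then show ?thesis using that by auto
qed

lemma (in matroid) wt_eqI:
  assumes "\<And>B. B \<in> bases M \<Longrightarrow> sum w B \<le> k" "B \<in> bases M" "sum w B = k"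
  shows "wt M w = k"
  using assms finite_bases unfolding wt_def by (intro Max_eqI) auto

lemma (in matroid) wt_cong:
  assumes "\<And>e. e \<in> ground M \<Longrightarrow> v e = w e"
  shows "wt M v = wt M w"
proof -
  have "sum v B = sum w B" if "B \<in> bases M" for B
    using assms bases_subset[OF that] by (intro sum.cong) auto
  then show ?thesis by (simp add: wt_def)
qed

section \<open>Ranks in initial matroids\<close>

lemma ground_initial_matroid [simp]: "ground (initial_matroid M w) = ground M"
  by (simp add: initial_matroid_def)

lemma bases_initial_matroid:
  "B \<in> bases (initial_matroid M w) \<longleftrightarrow> B \<in> bases M \<and> sum w B = wt M w"
  by (simp add: initial_matroid_def)

lemma (in matroid) finite_card_indep:
  "finite (card ` {X. X \<subseteq> S \<and> indep (initial_matroid M w) X})"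
proof -
  have "{X. X \<subseteq> S \<and> indep (initial_matroid M w) X} \<subseteq> Pow (ground M)"
    using bases_subset by (force simp: indep_def bases_initial_matroid)
  then show ?thesis using finite_ground by (meson finite_Pow_iff finite_imageI finite_subset)
qed

text \<open>Together with \<open>rank_initial_attained\<close> this describes the rank of
  \<open>S\<close> as the maximum of \<open>card (B \<inter> S)\<close> over bases, the quantity
  that the tie-breaker \<open>1_S\<close> measures.\<close>

lemma (in matroid) card_Int_le_rank_initial:
  assumes "B \<in> bases (initial_matroid M w)"
  shows "card (B \<inter> S) \<le> rank_of (initial_matroid M w) S"
  unfolding rank_of_def using assms
  by (intro Max_ge finite_card_indep imageI) (auto simp: indep_def)

lemma (in matroid) rank_initial_attained:
  obtains B where "B \<in> bases (initial_matroid M w)"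
    "card (B \<inter> S) = rank_of (initial_matroid M w) S"
proof -
  let ?N = "initial_matroid M w"
  obtain B0 where "B0 \<in> bases ?N"
    using wt_attained by (metis bases_initial_matroid)
  then have "{} \<in> {X. X \<subseteq> S \<and> indep ?N X}" by (auto simp: indep_def)
  then have "rank_of ?N S \<in> card ` {X. X \<subseteq> S \<and> indep ?N X}"
    unfolding rank_of_def by (intro Max_in finite_card_indep) blast
  then obtain X B where X: "X \<subseteq> S" "X \<subseteq> B" "B \<in> bases ?N" "card X = rank_of ?N S"
    by (auto simp: indep_def)
  have "finite B" using X(3) finite_base by (simp add: bases_initial_matroid)
  then have "card X \<le> card (B \<inter> S)" using X by (intro card_mono) auto
  then show ?thesis using that X card_Int_le_rank_initial[OF X(3), of S] by fastforce
qed

text \<open>Bases of the initial matroid are bases of \<open>M\<close>, so exchange in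
  \<open>M\<close> already fixes their size.\<close>

lemma (in matroid) total_rank_initial_matroid:
  assumes "B \<in> bases M"
  shows "total_rank (initial_matroid M w) = card B"
proof -
  obtain B' where B': "B' \<in> bases (initial_matroid M w)"
    "card (B' \<inter> ground M) = rank_of (initial_matroid M w) (ground M)"
    by (rule rank_initial_attained)
  then have "B' \<in> bases M" by (simp add: bases_initial_matroid)
  then have "B' \<inter> ground M = B'" "card B' = card B"
    using bases_subset[of B'] card_bases_eq[of B' B] assms by blast+
  then show ?thesis using B'(2) by (simp add: total_rank_def)
qed

lemma (in matroid) total_rank_initial_matroid_eq:
  "total_rank (initial_matroid M w) = total_rank M"
proof -
  obtain B where B: "B \<in> bases M" using bases_nonempty by blast
  \<comment> \<open>For the zero weight every base is maximal, so \<open>M\<close> is itself an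
    initial matroid and the previous lemma computes its rank too.\<close>
  then have "wt M (\<lambda>_. 0) = 0" by (intro wt_eqI) auto
  then have "initial_matroid M (\<lambda>_. 0) = M"
    by (intro basis_system.equality) (simp_all add: initial_matroid_def)
  then show ?thesis using total_rank_initial_matroid[OF B] by metis
qed

section \<open>Tie-breaking weights \<open>k w + 1_S\<close>\<close>

definition perturbed :: "nat \<Rightarrow> ('a \<Rightarrow> nat) \<Rightarrow> 'a set \<Rightarrow> 'a \<Rightarrow> nat" where
  "perturbed k w S = (\<lambda>e. k * w e + of_bool (e \<in> S))"

lemma sum_perturbed: "finite B \<Longrightarrow> sum (perturbed k w S) B = k * sum w B + card (B \<inter> S)"
  by (simp add: perturbed_def sum.distrib sum_distrib_left of_bool_def sum.If_cases)

text \<open>Weights are integers, so a base that is not \<open>w\<close>-maximal loses at least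
  \<open>k\<close> in the first term, while \<open>card (B \<inter> S)\<close> is at most
  \<open>card (ground M) \<le> k\<close>.\<close>

lemma (in matroid) wt_perturbed:
  assumes "card (ground M) \<le> k"
  shows "wt M (perturbed k w S) = k * wt M w + rank_of (initial_matroid M w) S"
proof -
  obtain B0 where B0: "B0 \<in> bases (initial_matroid M w)"
    "card (B0 \<inter> S) = rank_of (initial_matroid M w) S"
    by (rule rank_initial_attained)
  show ?thesis
  proof (rule wt_eqI)
    fix B assume B: "B \<in> bases M"
    show "sum (perturbed k w S) B \<le> k * wt M w + rank_of (initial_matroid M w) S"
    proof (cases "sum w B = wt M w")
      case True
      then show ?thesis
        using B card_Int_le_rank_initial[of B w S]
        by (simp add: sum_perturbed finite_base bases_initial_matroid)
    next
      case False
      then have "sum w B + 1 \<le> wt M w" using sum_le_wt[OF B, of w] by simp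
      then have "k * sum w B + k \<le> k * wt M w"
        by (metis add_mult_distrib2 mult.right_neutral mult_le_mono2)
      moreover have "card (B \<inter> S) \<le> k"
        using assms card_mono[OF finite_ground, of "B \<inter> S"] bases_subset[OF B] by force
      ultimately show ?thesis using B by (simp add: sum_perturbed finite_base)
    qed
  next
    show "B0 \<in> bases M" using B0 by (simp add: bases_initial_matroid)
    then show "sum (perturbed k w S) B0 = k * wt M w + rank_of (initial_matroid M w) S"
      using B0 by (simp add: sum_perturbed finite_base bases_initial_matroid)
  qed
qed

section \<open>Coefficients of the magnitude\<close>

definition weightings :: "'a set \<Rightarrow> nat \<Rightarrow> ('a \<Rightarrow> nat) set" where
  "weightings E n = {w \<in> E \<rightarrow>\<^sub>E UNIV. sum w E = n}"

lemma finite_weightings: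
  assumes "finite E"
  shows "finite (weightings E n)"
proof (rule finite_subset)
  show "weightings E n \<subseteq> E \<rightarrow>\<^sub>E {..n}"
  proof
    fix w assume w: "w \<in> weightings E n"
    then have "w e \<le> n" if "e \<in> E" for e
      using assms member_le_sum[of e E w] that by (auto simp: weightings_def)
    with w show "w \<in> E \<rightarrow>\<^sub>E {..n}" by (auto simp: weightings_def PiE_iff)
  qed
qed (use assms in \<open>simp add: finite_PiE\<close>)

text \<open>For odd \<open>k \<ge> card (ground M)\<close> this is the zeta summand of
  \<open>w\<close> at \<open>x = -1\<close>, written through \<open>wt M\<close> alone. A free
  \<open>k\<close> lets several matroids share one value.\<close>

definition mag_term :: "nat \<Rightarrow> 'a basis_system \<Rightarrow> ('a \<Rightarrow> nat) \<Rightarrow> int" where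
  "mag_term k M w = (\<Sum>S\<in>Pow (ground M). (- 1) ^ (card S + wt M (perturbed k w S)))"

lemma (in matroid) fps_nth_Mag:
  assumes "odd k" "card (ground M) \<le> k"
  shows "fps_nth (Mag M) n = (\<Sum>w\<in>weightings (ground M) n. mag_term k M w)"
proof -
  have "eval_minus_one ((- 1) ^ card S *
      xpow (int (total_rank (initial_matroid M w)) - int (rank_of (initial_matroid M w) S)) *
      xpow (- int (total_rank M) - int (wt M w))) =
    (- 1) ^ (card S + wt M (perturbed k w S))" for w S
  proof -
    let ?r = "rank_of (initial_matroid M w) S"
    \<comment> \<open>The two total ranks cancel.\<close>
    have "int (total_rank (initial_matroid M w)) - int ?r + (- int (total_rank M) - int (wt M w))
        = - int (?r + wt M w)"
      by (simp add: total_rank_initial_matroid_eq)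
    \<comment> \<open>Here \<open>k\<close> must be odd: then \<open>k * wt M w\<close> and
      \<open>wt M w\<close> have the same parity.\<close>
    moreover have "(- 1 :: int) ^ (wt M (perturbed k w S)) = (- 1) ^ (?r + wt M w)"
      using assms by (simp add: wt_perturbed power_add power_mult)
    ultimately show ?thesis
      by (simp add: mult.assoc xpow_mult eval_minus_one_sign_mult eval_minus_one_xpow power_add
          flip: of_nat_add)
  qed
  then show ?thesis
    by (simp add: Mag_def motivic_zeta_def char_poly_def mag_term_def weightings_def
        eval_minus_one_sum sum_distrib_right)
qed

text \<open>Allows weights to be restricted, glued or transported freely outside the ground
  set.\<close>

lemma (in matroid) mag_term_cong:
  assumes "\<And>e. e \<in> ground M \<Longrightarrow> v e = w e"
  shows "mag_term k M v = mag_term k M w"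
proof -
  have "wt M (perturbed k v S) = wt M (perturbed k w S)" for S
    using assms by (intro wt_cong) (simp add: perturbed_def)
  then show ?thesis by (simp add: mag_term_def)
qed

section \<open>Direct sums and isomorphisms\<close>

lemma direct_sum_simps [simp]:
  "ground (direct_sum M N) = ground M \<union> ground N"
  "bases (direct_sum M N) = {A \<union> B |A B. A \<in> bases M \<and> B \<in> bases N}"
  by (simp_all add: direct_sum_def)

text \<open>The exchange takes place in the summand containing \<open>a\<close>; disjointness leaves
  the other summand untouched.\<close>

lemma matroid_direct_sum:
  assumes "matroid M" "matroid N" and disj: "ground M \<inter> ground N = {}"
  shows "matroid (direct_sum M N)"
proof -
  interpret M: matroid M by fact
  interpret N: matroid N by fact
  show ?thesis
  proof
    show "finite (ground (direct_sum M N))"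
      using M.finite_ground N.finite_ground by simp
    show "B \<subseteq> ground (direct_sum M N)" if "B \<in> bases (direct_sum M N)" for B
      using that M.bases_subset N.bases_subset by fastforce
    show "bases (direct_sum M N) \<noteq> {}"
      using M.bases_nonempty N.bases_nonempty by auto
    fix A B a
    assume "A \<in> bases (direct_sum M N)" "B \<in> bases (direct_sum M N)" and a: "a \<in> A - B"
    then obtain A1 A2 B1 B2 where A: "A = A1 \<union> A2" "A1 \<in> bases M" "A2 \<in> bases N"
      and B: "B = B1 \<union> B2" "B1 \<in> bases M" "B2 \<in> bases N" by auto
    have sub: "A1 \<subseteq> ground M" "B1 \<subseteq> ground M" "A2 \<subseteq> ground N" "B2 \<subseteq> ground N"
      using A B M.bases_subset N.bases_subset by blast+
    show "\<exists>b\<in>B - A. insert b (A - {a}) \<in> bases (direct_sum M N)"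
    proof (cases "a \<in> A1")
      case True
      then obtain b where b: "b \<in> B1 - A1" "insert b (A1 - {a}) \<in> bases M"
        using M.bases_exchange[OF A(2) B(2)] a B(1) by blast
      have "insert b (A - {a}) = insert b (A1 - {a}) \<union> A2"
        using A(1) True sub disj by blast
      then have "insert b (A - {a}) \<in> bases (direct_sum M N)" using b(2) A(3) unfolding direct_sum_simps by blast
      moreover have "b \<in> B - A" using b(1) A(1) B(1) sub disj by blast
      ultimately show ?thesis by blast
    next
      case False
      then obtain b where b: "b \<in> B2 - A2" "insert b (A2 - {a}) \<in> bases N"
        using N.bases_exchange[OF A(3) B(3)] a A(1) B(1) by blast
      have "insert b (A - {a}) = A1 \<union> insert b (A2 - {a})"
        using A(1) False sub disj by blast
      then have "insert b (A - {a}) \<in> bases (direct_sum M N)" using b(2) A(2) unfolding direct_sum_simps by blast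
      moreover have "b \<in> B - A" using b(1) A(1) B(1) sub disj by blast
      ultimately show ?thesis by blast
    qed
  qed
qed

text \<open>The two parts of a base can be maximised independently.\<close>

lemma wt_direct_sum:
  assumes "matroid M" "matroid N" and disj: "ground M \<inter> ground N = {}"
  shows "wt (direct_sum M N) w = wt M w + wt N w"
proof -
  interpret M: matroid M by fact
  interpret N: matroid N by fact
  interpret D: matroid "direct_sum M N" using assms by (rule matroid_direct_sum)
  have sum_Un: "sum w (A \<union> B) = sum w A + sum w B" if "A \<in> bases M" "B \<in> bases N" for A B
  proof (rule sum.union_disjoint)
    show "A \<inter> B = {}" using that M.bases_subset N.bases_subset disj by blast
  qed (use that M.finite_base N.finite_base in auto)
  obtain A where A: "A \<in> bases M" "sum w A = wt M w" by (rule M.wt_attained)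
  obtain B where B: "B \<in> bases N" "sum w B = wt N w" by (rule N.wt_attained)
  show ?thesis
  proof (rule D.wt_eqI)
    show "sum w C \<le> wt M w + wt N w" if "C \<in> bases (direct_sum M N)" for C
      using that by (auto simp: sum_Un intro!: add_mono M.sum_le_wt N.sum_le_wt)
    show "A \<union> B \<in> bases (direct_sum M N)" using A B by auto
    show "sum w (A \<union> B) = wt M w + wt N w" using A B by (simp add: sum_Un)
  qed
qed

text \<open>Subsets of a disjoint union are pairs of subsets, and both summands of the exponent are
  additive over such pairs.\<close>

lemma mag_term_direct_sum:
  assumes "matroid M" "matroid N" and disj: "ground M \<inter> ground N = {}"
  shows "mag_term k (direct_sum M N) w = mag_term k M w * mag_term k N w"
proof -
  interpret M: matroid M by fact
  interpret N: matroid N by fact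
  have "mag_term k M w * mag_term k N w = (\<Sum>(S, T)\<in>Pow (ground M) \<times> Pow (ground N).
      (- 1) ^ (card S + wt M (perturbed k w S)) * (- 1) ^ (card T + wt N (perturbed k w T)))"
    by (simp add: mag_term_def sum_product sum.cartesian_product)
  also have "\<dots> = (\<Sum>U\<in>Pow (ground M \<union> ground N).
      (- 1) ^ (card U + wt (direct_sum M N) (perturbed k w U)))"
  proof (rule sum.reindex_bij_witness[where i = "\<lambda>U. (U \<inter> ground M, U \<inter> ground N)"
        and j = "\<lambda>(S, T). S \<union> T"], goal_cases)
    case (5 p)
    then obtain S T where p: "p = (S, T)" "S \<subseteq> ground M" "T \<subseteq> ground N" by auto
    have "finite S" "finite T" "S \<inter> T = {}"
      using p M.finite_ground N.finite_ground disj finite_subset by blast+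
    then have "card (S \<union> T) = card S + card T" by (intro card_Un_disjoint)
    \<comment> \<open>On \<open>ground M\<close> the sets \<open>S \<union> T\<close> and
      \<open>S\<close> coincide, and \<open>wt M\<close> sees nothing else.\<close>
    moreover have "wt M (perturbed k w (S \<union> T)) = wt M (perturbed k w S)"
      using p disj by (intro M.wt_cong) (auto simp: perturbed_def)
    moreover have "wt N (perturbed k w (S \<union> T)) = wt N (perturbed k w T)"
      using p disj by (intro N.wt_cong) (auto simp: perturbed_def)
    ultimately show ?case using assms p by (simp add: wt_direct_sum power_add)
  qed (use disj in auto)
  finally show ?thesis by (simp add: mag_term_def)
qed

lemma Mag_direct_sum:
  assumes "matroid M" "matroid N" and disj: "ground M \<inter> ground N = {}"
  shows "Mag (direct_sum M N) = Mag M * Mag N"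
proof (rule fps_ext)
  fix n
  interpret M: matroid M by fact
  interpret N: matroid N by fact
  interpret D: matroid "direct_sum M N" using assms by (rule matroid_direct_sum)
  let ?E = "ground M" and ?F = "ground N"
  \<comment> \<open>One odd multiplier that is large enough for both summands and their direct
    sum.\<close>
  define k where "k = 2 * card (?E \<union> ?F) + 1"
  have card: "card ?E \<le> k" "card ?F \<le> k" "card (?E \<union> ?F) \<le> k"
    using card_mono[of "?E \<union> ?F"] M.finite_ground N.finite_ground by (force simp: k_def)+
  have "odd k" by (simp add: k_def)
  have "fps_nth (Mag M * Mag N) n
      = (\<Sum>j=0..n. \<Sum>(v, w)\<in>weightings ?E j \<times> weightings ?F (n - j). mag_term k M v * mag_term k N w)"
    using \<open>odd k\<close> card by (simp add: fps_mult_nth M.fps_nth_Mag N.fps_nth_Mag sum_product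
        sum.cartesian_product)
  also have "\<dots> = (\<Sum>(j, v, w)\<in>(SIGMA j:{0..n}. weightings ?E j \<times> weightings ?F (n - j)).
      mag_term k M v * mag_term k N w)"
    using M.finite_ground N.finite_ground
    by (subst sum.Sigma) (auto simp: finite_weightings)
  \<comment> \<open>A weighting of the union is a pair of weightings; the Cauchy product index
    \<open>j\<close> is recovered as the total on \<open>?E\<close>.\<close>
  also have "\<dots> = (\<Sum>w\<in>weightings (?E \<union> ?F) n. mag_term k M w * mag_term k N w)"
  proof (rule sum.reindex_bij_witness[where
        i = "\<lambda>w. (sum w ?E, restrict w ?E, restrict w ?F)" and
        j = "\<lambda>(_, v, w) e. if e \<in> ?E then v e else w e"], goal_cases)
    case (1 p)
    then obtain j v w where p: "p = (j, v, w)" "j \<le> n" "v \<in> weightings ?E j"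
      "w \<in> weightings ?F (n - j)" by auto
    have "restrict (\<lambda>e. if e \<in> ?E then v e else w e) ?E = v"
      using p by (auto simp: weightings_def fun_eq_iff PiE_iff extensional_def)
    moreover have "restrict (\<lambda>e. if e \<in> ?E then v e else w e) ?F = w"
      using p disj by (auto simp: weightings_def fun_eq_iff PiE_iff extensional_def)
    moreover have "(\<Sum>e\<in>?E. if e \<in> ?E then v e else w e) = j"
      using p by (simp add: weightings_def)
    ultimately show ?case using p by simp
  next
    case (2 p)
    then obtain j v w where p: "p = (j, v, w)" "j \<le> n" "v \<in> weightings ?E j"
      "w \<in> weightings ?F (n - j)" by auto
    have "(\<Sum>e\<in>?E \<union> ?F. if e \<in> ?E then v e else w e) = 
      (\<Sum>e\<in>?E. if e \<in> ?E then v e else w e) + (\<Sum>e\<in>?F. if e \<in> ?E then v e else w e)"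
      using M.finite_ground N.finite_ground disj by (intro sum.union_disjoint)
    moreover have "(\<Sum>e\<in>?F. if e \<in> ?E then v e else w e) = (\<Sum>e\<in>?F. w e)"
      using disj by (intro sum.cong) auto
    ultimately have "(\<Sum>e\<in>?E \<union> ?F. if e \<in> ?E then v e else w e) = n"
      using p by (simp add: weightings_def)
    then show ?case using p by (auto simp: weightings_def PiE_iff extensional_def)
  next
    case (3 w)
    then show ?case by (auto simp: weightings_def fun_eq_iff PiE_iff extensional_def)
  next
    case (4 w)
    then have "sum w ?E + sum w ?F = n"
      using M.finite_ground N.finite_ground disj by (simp add: weightings_def sum.union_disjoint)
    then show ?case by (auto simp: weightings_def)
  next
    case (5 p)
    then obtain j v w where p: "p = (j, v, w)" by (cases p)
    have "mag_term k M (\<lambda>e. if e \<in> ?E then v e else w e) = mag_term k M v"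
      by (intro M.mag_term_cong) auto
    moreover have "mag_term k N (\<lambda>e. if e \<in> ?E then v e else w e) = mag_term k N w"
      using disj by (intro N.mag_term_cong) auto
    ultimately show ?case using p by simp
  qed
  also have "\<dots> = fps_nth (Mag (direct_sum M N)) n"
    using \<open>odd k\<close> card assms by (simp add: D.fps_nth_Mag mag_term_direct_sum)
  finally show "fps_nth (Mag (direct_sum M N)) n = fps_nth (Mag M * Mag N) n" ..
qed

section \<open>Invariance under isomorphism\<close>

lemma wt_iso:
  assumes "matroid M" and iso: "matroid_iso f M N"
  shows "wt N w = wt M (w \<circ> f)"
proof -
  interpret matroid M by fact
  have "sum w (f ` B) = sum (w \<circ> f) B" if "B \<in> bases M" for B
  proof (rule sum.reindex)
    show "inj_on f B"
      using iso bases_subset[OF that] by (metis matroid_iso_def bij_betw_def inj_on_subset)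
  qed
  then have "sum w ` bases N = sum (w \<circ> f) ` bases M"
    using iso by (force simp: matroid_iso_def image_image)
  then show ?thesis by (simp add: wt_def)
qed

lemma mag_term_iso:
  assumes "matroid M" and iso: "matroid_iso f M N"
  shows "mag_term k N w = mag_term k M (w \<circ> f)"
proof -
  interpret matroid M by fact
  have f: "bij_betw f (ground M) (ground N)" using iso by (simp add: matroid_iso_def)
  have "mag_term k N w = (\<Sum>S\<in>Pow (ground M).
      (- 1) ^ (card (f ` S) + wt N (perturbed k w (f ` S))))"
    unfolding mag_term_def using f
    by (intro sum.reindex_bij_betw[symmetric]) (rule bij_betw_Pow)
  also have "\<dots> = mag_term k M (w \<circ> f)"
    unfolding mag_term_def
  proof (rule sum.cong)
    fix S assume S: "S \<in> Pow (ground M)"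
    have inj: "inj_on f (ground M)" using f by (simp add: bij_betw_def)
    have "card (f ` S) = card S"
      using S inj by (auto intro: card_image inj_on_subset)
    moreover have "wt M (perturbed k w (f ` S) \<circ> f) = wt M (perturbed k (w \<circ> f) S)"
      using S inj by (intro wt_cong) (auto simp: perturbed_def inj_on_image_mem_iff)
    ultimately show "(- 1) ^ (card (f ` S) + wt N (perturbed k w (f ` S)))
        = ((- 1) ^ (card S + wt M (perturbed k (w \<circ> f) S)) :: int)"
      using assms by (simp add: wt_iso)
  qed simp
  finally show ?thesis .
qed

lemma Mag_iso:
  assumes "matroid M" "matroid N" and iso: "matroid_iso f M N"
  shows "Mag M = Mag N"
proof (rule fps_ext)
  fix n
  interpret M: matroid M by fact
  interpret N: matroid N by fact
  have f: "bij_betw f (ground M) (ground N)" using iso by (simp add: matroid_iso_def)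
  define g where "g = inv_into (ground M) f"
  have fE: "f e \<in> ground N" and gf: "g (f e) = e" if "e \<in> ground M" for e
    using f that by (auto simp: g_def bij_betw_def)
  have gE: "g e \<in> ground M" and fg: "f (g e) = e" if "e \<in> ground N" for e
    using f that by (auto simp: g_def bij_betw_def inv_into_into f_inv_into_f)
  define k where "k = 2 * card (ground M) + 1"
  have k: "odd k" "card (ground M) \<le> k" "card (ground N) \<le> k"
    using bij_betw_same_card[OF f] by (auto simp: k_def)
  have "(\<Sum>w\<in>weightings (ground M) n. mag_term k M w)
      = (\<Sum>w\<in>weightings (ground N) n. mag_term k N w)"
  \<comment> \<open>Weightings are transported by composing with \<open>f\<close> and its inverse
    \<open>g\<close>; restricting makes the results extensional again.\<close>
  proof (rule sum.reindex_bij_witness[where i = "\<lambda>w. restrict (w \<circ> f) (ground M)"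
        and j = "\<lambda>w. restrict (w \<circ> g) (ground N)"], goal_cases)
    case (1 w)
    then show ?case by (auto simp: weightings_def fun_eq_iff fE gf PiE_iff extensional_def)
  next
    case (2 w)
    have "(\<Sum>e\<in>ground N. w (g e)) = (\<Sum>e\<in>ground M. w e)"
      using f unfolding g_def by (intro sum.reindex_bij_betw bij_betw_inv_into)
    then show ?case using 2 by (simp add: weightings_def)
  next
    case (3 w)
    then show ?case by (auto simp: weightings_def fun_eq_iff gE fg PiE_iff extensional_def)
  next
    case (4 w)
    have "(\<Sum>e\<in>ground M. w (f e)) = (\<Sum>e\<in>ground N. w e)"
      using f by (intro sum.reindex_bij_betw)
    then show ?case using 4 by (simp add: weightings_def)
  next
    case (5 w)
    have "mag_term k M (restrict (w \<circ> g) (ground N) \<circ> f) = mag_term k M w"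
      by (intro M.mag_term_cong) (simp add: fE gf)
    then show ?case using assms by (simp add: mag_term_iso)
  qed
  then show "fps_nth (Mag M) n = fps_nth (Mag N) n"
    using k by (simp add: M.fps_nth_Mag N.fps_nth_Mag)
qed

section \<open>Valuativity\<close>

text \<open>The norm sums the norms of all coordinates, hence dominates each one.\<close>

lemma bounded_linear_lookup:
  "bounded_linear (\<lambda>x :: 'a \<Rightarrow>\<^sub>0 'b::real_normed_vector. Poly_Mapping.lookup x e)"
proof (rule bounded_linear_intro[where K = 1])
  fix x y :: "'a \<Rightarrow>\<^sub>0 'b" and r :: real
  show "Poly_Mapping.lookup (x + y) e = Poly_Mapping.lookup x e + Poly_Mapping.lookup y e"
    by (rule lookup_add)
  have "finite {i. r *\<^sub>R Poly_Mapping.lookup x i \<noteq> 0}"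
    by (rule finite_subset[OF _ finite_lookup[of x]]) auto
  then show "Poly_Mapping.lookup (r *\<^sub>R x) e = r *\<^sub>R Poly_Mapping.lookup x e"
    by (simp add: scaleR_poly_mapping_def)
  show "norm (Poly_Mapping.lookup x e) \<le> norm x * 1"
  proof (cases "e \<in> Poly_Mapping.keys x")
    case True
    then show ?thesis
      by (auto simp: norm_poly_mapping_def dist_poly_mapping_def intro: member_le_sum)
  next
    case False
    then show ?thesis by (simp add: in_keys_iff)
  qed
qed

lemma lookup_indicator_vec:
  "finite B \<Longrightarrow> Poly_Mapping.lookup (indicator_vec B) e = of_bool (e \<in> B)"
  by (simp add: indicator_vec_def lookup_sum lookup_single when_def)

section \<open>Weights as linear functionals on the base polytope\<close>

definition weight_functional :: "'a set \<Rightarrow> ('a \<Rightarrow> nat) \<Rightarrow> ('a \<Rightarrow>\<^sub>0 real) \<Rightarrow> real" where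
  "weight_functional E u x = (\<Sum>e\<in>E. real (u e) * Poly_Mapping.lookup x e)"

lemma bounded_linear_weight_functional: "bounded_linear (weight_functional E u)"
  unfolding weight_functional_def
  by (intro bounded_linear_sum bounded_linear_const_mult bounded_linear_lookup)

context matroid
begin

lemma weight_functional_indicator_vec:
  assumes "B \<in> bases M"
  shows "weight_functional (ground M) u (indicator_vec B) = real (sum u B)"
proof -
  have "weight_functional (ground M) u (indicator_vec B)
      = (\<Sum>e\<in>ground M. if e \<in> B then real (u e) else 0)"
    unfolding weight_functional_def
    using finite_base[OF assms] by (intro sum.cong) (auto simp: lookup_indicator_vec)
  also have "\<dots> = real (sum u B)"
    using finite_ground bases_subset[OF assms] by (simp add: sum.If_cases Int_absorb1)
  finally show ?thesis .
qed

text \<open>The half-space where the functional is at most \<open>wt M u\<close> is convex and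
  contains all vertices, hence the polytope; a maximizing base attains the bound.\<close>

lemma Sup_base_polytope:
  "Sup (weight_functional (ground M) u ` base_polytope M) = real (wt M u)"
proof (rule cSup_eq_maximum)
  obtain B where "B \<in> bases M" "sum u B = wt M u" by (rule wt_attained)
  then show "real (wt M u) \<in> weight_functional (ground M) u ` base_polytope M"
    unfolding base_polytope_def
    by (metis hull_inc imageI weight_functional_indicator_vec)
next
  fix y assume "y \<in> weight_functional (ground M) u ` base_polytope M"
  moreover have "base_polytope M \<subseteq> weight_functional (ground M) u -` {..real (wt M u)}"
    unfolding base_polytope_def
  proof (rule hull_minimal)
    show "convex (weight_functional (ground M) u -` {..real (wt M u)})"
      by (intro convex_linear_vimage bounded_linear.linear bounded_linear_weight_functional) auto
    show "indicator_vec ` bases M \<subseteq> weight_functional (ground M) u -` {..real (wt M u)}"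
    proof
      fix x assume "x \<in> indicator_vec ` bases M"
      then obtain B where "x = indicator_vec B" "B \<in> bases M" by blast
      then show "x \<in> weight_functional (ground M) u -` {..real (wt M u)}"
        using sum_le_wt[of B u] by (simp only: vimage_eq atMost_iff weight_functional_indicator_vec of_nat_le_iff)
    qed
  qed
  ultimately show "y \<le> real (wt M u)" by auto
qed

lemma base_polytope_nonempty: "base_polytope M \<noteq> {}"
  using bases_nonempty by (simp add: base_polytope_def)

lemma compact_base_polytope: "compact (base_polytope M)"
  unfolding base_polytope_def using finite_bases by (intro finite_imp_compact_convex_hull) simp

text \<open>Outside \<open>real_space\<close> the indicators vanish, so a relation assumed on
  \<open>real_space E\<close> extends to all points.\<close>

lemma base_polytope_subset: "base_polytope M \<subseteq> real_space (ground M)"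
  unfolding base_polytope_def
proof (rule hull_minimal)
  have "real_space (ground M) = (\<Inter>e\<in>- ground M. (\<lambda>x. Poly_Mapping.lookup x e) -` {0})"
    by (auto simp: real_space_def in_keys_iff)
  also have "convex \<dots>"
    by (intro convex_INT convex_linear_vimage bounded_linear.linear bounded_linear_lookup) auto
  finally show "convex (real_space (ground M))" .
  show "indicator_vec ` bases M \<subseteq> real_space (ground M)"
    using bases_subset finite_base by (fastforce simp: real_space_def in_keys_iff lookup_indicator_vec)
qed

end

text \<open>The coordinates in \<open>E\<close> separate points of the polytopes, and
  \<open>wt (M i) u\<close> is the maximum of \<open>weight_functional E u\<close>, so
  \<open>sum_Sup_eq_0\<close> applies.\<close>

lemma sum_wt_level_eq_0:
  fixes c :: "'i \<Rightarrow> int"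
  assumes fin: "finite I" and M: "\<And>i. i \<in> I \<Longrightarrow> matroid (M i)" "\<And>i. i \<in> I \<Longrightarrow> ground (M i) = E"
    and zero: "\<And>x. x \<in> real_space E \<Longrightarrow> (\<Sum>i\<in>I. c i * indicator (base_polytope (M i)) x) = 0"
  shows "(\<Sum>i | i \<in> I \<and> wt (M i) u = k. c i) = 0"
proof (cases "I = {}")
  case False
  \<comment> \<open>Finiteness of \<open>E\<close> comes from a member of the family, which is why
    the empty family is treated apart.\<close>
  then have "finite E" using M matroid.finite_ground by blast
  have sub: "base_polytope (M i) \<subseteq> real_space E" if "i \<in> I" for i
    using M that matroid.base_polytope_subset by blast
  have "(\<Sum>i | i \<in> I \<and> base_polytope (M i) \<noteq> {} \<and>
      Sup (weight_functional E u ` base_polytope (M i)) = real k. c i) = 0"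
  proof (rule sum_Sup_eq_0[where F = E and f = "\<lambda>e x. Poly_Mapping.lookup x e"])
    fix x y
    assume "x \<in> (\<Union>i\<in>I. base_polytope (M i))" "y \<in> (\<Union>i\<in>I. base_polytope (M i))"
    then have "x \<in> real_space E" "y \<in> real_space E" using sub by auto
    moreover assume "\<And>e. e \<in> E \<Longrightarrow> Poly_Mapping.lookup x e = Poly_Mapping.lookup y e"
    ultimately show "x = y"
      by (intro poly_mapping_eqI) (metis in_keys_iff mem_Collect_eq real_space_def subsetD)
  next
    fix x
    have "(\<Sum>i | i \<in> I \<and> x \<in> base_polytope (M i). c i)
        = (\<Sum>i\<in>I. if x \<in> base_polytope (M i) then c i else 0)"
      using fin by (rule sum.inter_filter)
    also have "\<dots> = (\<Sum>i\<in>I. c i * indicator (base_polytope (M i)) x)"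
      by (intro sum.cong) (auto simp: indicator_def)
    also have "\<dots> = 0"
    proof (cases "x \<in> real_space E")
      case False
      then show ?thesis using sub by (intro sum.neutral) (auto simp: indicator_def)
    qed (rule zero)
    finally show "(\<Sum>i | i \<in> I \<and> x \<in> base_polytope (M i). c i) = 0" .
  qed (use fin M \<open>finite E\<close> matroid.compact_base_polytope in
      \<open>auto simp: base_polytope_def bounded_linear_lookup bounded_linear_weight_functional\<close>)
  moreover have "{i \<in> I. base_polytope (M i) \<noteq> {} \<and>
      Sup (weight_functional E u ` base_polytope (M i)) = real k} = {i \<in> I. wt (M i) u = k}"
  proof (rule Collect_cong, rule conj_cong)
    fix i assume i: "i \<in> I"
    interpret matroid "M i" using M i by simp
    show "(base_polytope (M i) \<noteq> {} \<and>
        Sup (weight_functional E u ` base_polytope (M i)) = real k) = (wt (M i) u = k)"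
      using M(2)[OF i] Sup_base_polytope[of u] base_polytope_nonempty by simp
  qed simp
  ultimately show ?thesis by simp
qed simp

text \<open>Grouping by the value \<open>k\<close> of \<open>wt\<close> turns the sum into level
  sums, each zero, weighted by \<open>h k\<close>.\<close>

lemma sum_fun_wt_eq_0:
  fixes c :: "'i \<Rightarrow> int"
  assumes fin: "finite I" and "\<And>i. i \<in> I \<Longrightarrow> matroid (M i)" "\<And>i. i \<in> I \<Longrightarrow> ground (M i) = E"
    and "\<And>x. x \<in> real_space E \<Longrightarrow> (\<Sum>i\<in>I. c i * indicator (base_polytope (M i)) x) = 0"
  shows "(\<Sum>i\<in>I. c i * h (wt (M i) u)) = 0"
proof -
  have "(\<Sum>i\<in>I. c i * h (wt (M i) u))
      = (\<Sum>k\<in>(\<lambda>i. wt (M i) u) ` I. \<Sum>i | i \<in> I \<and> wt (M i) u = k. c i * h (wt (M i) u))"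
    using fin by (rule sum.image_gen)
  also have "\<dots> = (\<Sum>k\<in>(\<lambda>i. wt (M i) u) ` I. (\<Sum>i | i \<in> I \<and> wt (M i) u = k. c i) * h k)"
    by (simp add: sum_distrib_right)
  also have "\<dots> = 0"
    using sum_wt_level_eq_0[OF assms] by simp
  finally show ?thesis .
qed

lemma sum_Mag_eq_0:
  fixes c :: "'i \<Rightarrow> int"
  assumes "finite I" and M: "\<And>i. i \<in> I \<Longrightarrow> matroid (M i)" "\<And>i. i \<in> I \<Longrightarrow> ground (M i) = E"
    and "\<And>x. x \<in> real_space E \<Longrightarrow> (\<Sum>i\<in>I. c i * indicator (base_polytope (M i)) x) = 0"
  shows "(\<Sum>i\<in>I. fps_const (c i) * Mag (M i)) = 0"
proof (rule fps_ext)
  fix n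
  \<comment> \<open>This \<open>k\<close> depends only on the common ground set, so all
    \<open>M i\<close> are tested on the same weights \<open>perturbed k w S\<close>.\<close>
  define k where "k = 2 * card E + 1"
  have "fps_nth (Mag (M i)) n = (\<Sum>w\<in>weightings E n. mag_term k (M i) w)" if "i \<in> I" for i
    using matroid.fps_nth_Mag[OF M(1)[OF that], of k n] M(2)[OF that] by (simp add: k_def)
  then have "fps_nth (\<Sum>i\<in>I. fps_const (c i) * Mag (M i)) n
      = (\<Sum>i\<in>I. c i * (\<Sum>w\<in>weightings E n. mag_term k (M i) w))"
    by (simp add: fps_sum_nth)
  also have "\<dots> = (\<Sum>w\<in>weightings E n. \<Sum>i\<in>I. c i * mag_term k (M i) w)"
    unfolding sum_distrib_left by (rule sum.swap)
  also have "\<dots> = (\<Sum>w\<in>weightings E n. \<Sum>S\<in>Pow E.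
      \<Sum>i\<in>I. c i * (- 1) ^ (card S + wt (M i) (perturbed k w S)))"
  proof (rule sum.cong)
    fix w
    have "(\<Sum>i\<in>I. c i * mag_term k (M i) w)
        = (\<Sum>i\<in>I. \<Sum>S\<in>Pow E. c i * (- 1) ^ (card S + wt (M i) (perturbed k w S)))"
      using M by (simp add: mag_term_def sum_distrib_left)
    also have "\<dots> = (\<Sum>S\<in>Pow E. \<Sum>i\<in>I. c i * (- 1) ^ (card S + wt (M i) (perturbed k w S)))"
      by (rule sum.swap)
    finally show "(\<Sum>i\<in>I. c i * mag_term k (M i) w) = \<dots>" .
  qed simp
  also have "\<dots> = 0"
    \<comment> \<open>For fixed \<open>w\<close> and \<open>S\<close> the sign is a function
      \<open>h\<close> of the maximal weight, namely
      \<open>h m = (- 1) ^ (card S + m)\<close>.\<close>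
    by (intro sum.neutral ballI sum_fun_wt_eq_0[OF assms(1) M assms(4)])
  finally show "fps_nth (\<Sum>i\<in>I. fps_const (c i) * Mag (M i)) n = fps_nth 0 n" by simp
qed

theorem proposition4p3:
  shows "(\<forall>(M :: 'a basis_system) N.
            matroid M \<and> matroid N \<and> ground M \<inter> ground N = {} \<longrightarrow>
            Mag (direct_sum M N) = Mag M * Mag N)
    \<and> (\<forall>(M :: 'a basis_system) (N :: 'b basis_system) f.
            matroid M \<and> matroid N \<and> matroid_iso f M N \<longrightarrow> Mag M = Mag N)
    \<and> (\<forall>(E :: 'a set) (I :: 'i set) (M :: 'i \<Rightarrow> 'a basis_system) (c :: 'i \<Rightarrow> int).
            finite I \<and> (\<forall>i\<in>I. matroid (M i) \<and> ground (M i) = E) \<longrightarrow>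
            (\<forall>x\<in>real_space E. (\<Sum>i\<in>I. c i * indicator (base_polytope (M i)) x) = 0) \<longrightarrow>
            (\<Sum>i\<in>I. fps_const (c i) * Mag (M i)) = 0)"
proof (intro conjI allI impI; (elim conjE)?)
  fix E :: "'a set" and I :: "'i set" and M :: "'i \<Rightarrow> 'a basis_system" and c :: "'i \<Rightarrow> int"
  assume "finite I" "\<forall>i\<in>I. matroid (M i) \<and> ground (M i) = E"
    "\<forall>x\<in>real_space E. (\<Sum>i\<in>I. c i * indicator (base_polytope (M i)) x) = 0"
  then show "(\<Sum>i\<in>I. fps_const (c i) * Mag (M i)) = 0"
    by (intro sum_Mag_eq_0[where E = E]) simp_all
qed (fact Mag_direct_sum Mag_iso)+

end
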